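(* There exists an absolute constant $C>0$ such that for all integers $a\ge 0$, $d\ge 1$, $N\ge 1$ with $a\le \left(\frac{Nd-1}{2}\right)^2$ and $a\le \frac{N^{4/3}d^{4/3}}{200}$, the quantity $\delta_{a,d,N}:=\min\{|a+nd-m^2| : n,m\in\mathbb{Z},\ 0\le n\le N\}$ satisfies \[ \delta_{a,d,N}\le \begin{cases} C\,\dfrac{a^{1/2}}{N^{1/2}}, & \text{if } \max(Nd,N^{2/3}d^{4/3})\le a\le \dfrac{N^{4/3}d^{4/3}}{200},\\[2mm] C\,\dfrac{d}{a^{1/4}}, & \text{if } \max(Nd,d^{4/3})\le a\le N^{2/3}d^{4/3}. \end{cases} \] (Each bound holds whenever the corresponding condition holds.)
   Context: For integers $a\ge 0$, $d\ge 1$, $N\ge 1$, the quantity $\delta_{a,d,N}$ is the smallest distance between a term of the arithmetic progression $a,a+d,\dots,a+Nd$ and a perfect square. The condition $a\le \left(\frac{Nd-1}{2}\right)^2$ is equivalent to $\sqrt{a+Nd}-\sqrt{a}\ge 1$. *)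

theory Defs
  imports Complex_Main
begin

definition square_dist :: "int \<Rightarrow> int \<Rightarrow> int \<Rightarrow> int" where
  "square_dist a d N = (LEAST k. \<exists>n m :: int. 0 \<le> n \<and> n \<le> N \<and> k = \<bar>a + n * d - m\<^sup>2\<bar>)"

text \<open>The least element above really exists on the integers, so \<open>square_dist\<close> is the minimum.\<close>

lemma square_dist_attained_and_le:
  assumes "N \<ge> 0"
  shows square_dist_attained:
      "\<exists>n m :: int. 0 \<le> n \<and> n \<le> N \<and> square_dist a d N = \<bar>a + n * d - m\<^sup>2\<bar>"
    and square_dist_le:
      "\<And>n m :: int. 0 \<le> n \<Longrightarrow> n \<le> N \<Longrightarrow> square_dist a d N \<le> \<bar>a + n * d - m\<^sup>2\<bar>"
proof -
  define P where "P = (\<lambda>k::int. \<exists>n m :: int. 0 \<le> n \<and> n \<le> N \<and> k = \<bar>a + n * d - m\<^sup>2\<bar>)"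
  have P_nonneg: "k \<ge> 0" if "P k" for k
    using that unfolding P_def by auto
  have "P \<bar>a\<bar>"
    unfolding P_def using assms by (intro exI[of _ 0]) auto
  then have ex: "\<exists>j. P (int j)"
    using P_nonneg[of "\<bar>a\<bar>"] by (metis nonneg_int_cases)
  define j where "j = (LEAST j. P (int j))"
  have Pj: "P (int j)"
    unfolding j_def using ex by (rule LeastI_ex)
  have least: "int j \<le> k" if k: "P k" for k
  proof -
    obtain i where "k = int i"
      using P_nonneg[OF k] by (metis nonneg_int_cases)
    then show ?thesis
      using k Least_le[of "\<lambda>j. P (int j)" i] by (simp add: j_def)
  qed
  have eq: "square_dist a d N = int j"
    unfolding square_dist_def P_def[symmetric]
    using Pj least by (intro Least_equality) (auto simp: P_def)
  show "\<exists>n m :: int. 0 \<le> n \<and> n \<le> N \<and> square_dist a d N = \<bar>a + n * d - m\<^sup>2\<bar>"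
    using Pj unfolding eq by (simp add: P_def)
  show "square_dist a d N \<le> \<bar>a + n * d - m\<^sup>2\<bar>" if "0 \<le> n" "n \<le> N" for n m :: int
    unfolding eq using that by (intro least) (auto simp: P_def)
qed

end

theory Submission
  imports Defs "HOL-Analysis.Lipschitz" "HOL-Analysis.Kronecker_Approximation_Theorem"
begin

text \<open>
  Put \<open>f x = sqrt (a + d x)\<close>. If \<open>f n\<close> lies within \<open>\<epsilon>\<close> of an integer \<open>k\<close>, then
  \<open>a + n d - k\<^sup>2 = (f n - k) (f n + k)\<close> has size \<open>O(\<epsilon> sqrt a)\<close>, so both bounds are statements about
  how well \<open>f\<close> approaches the integers on \<open>{0..N}\<close>. As \<open>N d \<le> a\<close>, the second derivative of
  \<open>- f\<close> stays between \<open>\<kappa> / 3\<close> and \<open>\<kappa>\<close>, where \<open>\<kappa> = d\<^sup>2 / (4 a\<^bsup>3/2\<^esup>)\<close>.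
  The hypothesis \<open>a \<le> (N d)\<^bsup>4/3\<^esup> / 200\<close> says that \<open>\<kappa> N\<^sup>2\<close> exceeds a large constant. The two ranges
  of \<open>a\<close> are those in which \<open>\<kappa> \<le> 1 / (4 N)\<close> and \<open>1 / (4 N) \<le> \<kappa> \<le> 1 / 4\<close>. Everything therefore
  follows from one theorem on curved functions, \<open>near_integer_of_curved\<close>: some \<open>f n\<close> is within
  \<open>16 (sqrt \<kappa> + 1 / sqrt N)\<close> of an integer.

  To prove it, let \<open>p / q\<close> be a fraction close to a value of \<open>f'\<close>. Modulo 1 the number \<open>p n / q\<close> takes
  on each residue class of \<open>n\<close> modulo \<open>q\<close> a constant value, and all multiples of \<open>1 / q\<close> occur.
  So it is enough that the slowly varying function \<open>f x - p x / q\<close> meets some multiple of \<open>1 / q\<close>: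
  with \<open>n\<close> in the right residue class and at distance at most \<open>q\<close> from that point, the loss is at
  most \<open>q\<close> times the slope of \<open>f x - p x / q\<close> (\<open>near_integer_if_twist_varies\<close>). Starting near a stationary point of
  \<open>f x - p x / q\<close>, curvature makes it vary by \<open>1 / q\<close> over a length of about
  \<open>(\<kappa> q)\<^bsup>-1/2\<^esup>\<close>, at the end of which the loss is about \<open>sqrt (\<kappa> q)\<close>.

  It remains to choose \<open>p / q\<close> by Dirichlet's theorem. Over \<open>{0..N}\<close> the slope \<open>f'\<close> changes by about
  \<open>V = \<kappa> N\<close>. If \<open>V\<close> is large compared with \<open>1 / sqrt N\<close>, denominators up to \<open>O(1 + 1 / V)\<close> suffice to
  make \<open>p / q\<close> a value of \<open>f'\<close>, so there is a true stationary point, and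
  \<open>\<kappa> q = O(\<kappa> + 1 / N)\<close>. Otherwise \<open>q \<le> sqrt N / 2\<close> gives \<open>\<kappa> q = O(1 / N)\<close>; the slope error
  \<open>O(1 / sqrt N)\<close> of Dirichlet's theorem is then affordable, and no stationary point is needed.
\<close>

section \<open>From a slowly varying twist to a value near an integer\<close>

lemma residue_in_window:
  fixes w :: real and q r :: int
  assumes "q > 0"
  obtains n :: int where "w \<le> n" "n \<le> w + q" "q dvd n - r"
proof
  define c where "c = \<lceil>(w - r) / q\<rceil>"
  have q: "real_of_int q > 0" using assms by simp
  have "(w - r) / q \<le> c" "c \<le> (w - r) / q + 1"
    unfolding c_def by linarith+
  then have "w - r \<le> c * q" "c * q \<le> w - r + q"
    using q by (simp_all add: field_simps)
  then show "w \<le> real_of_int (r + q * c)" "real_of_int (r + q * c) \<le> w + q"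
    by (simp_all add: algebra_simps)
  show "q dvd r + q * c - r" by simp
qed

text \<open>
  The twist \<open>q f x - p x\<close> varies by at least 1, so it takes an integer value \<open>j\<close> at some real \<open>x\<close>.
  Coprimality makes \<open>p n + j = 0\<close> solvable modulo \<open>q\<close>, and such an \<open>n\<close> exists within distance
  \<open>q\<close> of \<open>x\<close>. There \<open>q f n\<close> differs from a multiple of \<open>q\<close> only by the change of the twist
  between \<open>x\<close> and \<open>n\<close>.
\<close>

lemma near_integer_if_twist_varies:
  fixes f :: "real \<Rightarrow> real" and p q :: int and u v \<epsilon> :: real
  assumes pq: "coprime p q" "q > 0"
    and long: "q \<le> v - u"
    and cont: "continuous_on {u..v} f"
    and lip: "\<And>(x::real) (y::real). x \<in> {u..v} \<Longrightarrow> y \<in> {u..v} \<Longrightarrow>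
               \<bar>(q * f x - p * x) - (q * f y - p * y)\<bar> \<le> \<epsilon> * \<bar>x - y\<bar>"
    and var: "1 \<le> \<bar>(q * f v - p * v) - (q * f u - p * u)\<bar>"
    and eps: "0 \<le> \<epsilon>"
  shows "\<exists>(n::int) (k::int). u \<le> n \<and> n \<le> v \<and> \<bar>f n - k\<bar> \<le> \<epsilon>"
proof -
  define g where "g x = q * f x - p * x" for x :: real
  have q0: "real_of_int q > 0" using pq by simp
  have uv: "u \<le> v" using long q0 by linarith
  have cg: "continuous_on {u..v} g"
    unfolding g_def by (intro continuous_intros cont)
  obtain x j where x: "x \<in> {u..v}" and j: "g x = real_of_int j"
  proof (cases "g u \<le> g v")
    case True
    then have "g u \<le> \<lceil>g u\<rceil>" "\<lceil>g u\<rceil> \<le> g v" using var unfolding g_def[symmetric] by linarith+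
    from IVT'[OF this uv cg] show ?thesis using that by auto
  next
    case False
    then have "g v \<le> \<lceil>g v\<rceil>" "\<lceil>g v\<rceil> \<le> g u" using var unfolding g_def[symmetric] by linarith+
    from IVT2'[OF this uv cg] show ?thesis using that by auto
  qed
  obtain b c where bc: "b * p + c * q = 1"
    using bezout_int[of p q] pq by (metis coprime_imp_gcd_eq_1)
  \<comment> \<open>A window of length \<open>q\<close> inside \<open>{u..v}\<close> that contains \<open>x\<close>.\<close>
  define w where "w = min x (v - q)"
  have w: "u \<le> w" "w \<le> x" "w + q \<le> v" "x \<le> w + q"
    using x long q0 unfolding w_def by auto
  obtain n where n: "w \<le> n" "n \<le> w + q" "q dvd n - (- j * b)"
    using residue_in_window[OF pq(2)] by blast
  have "p * n + j = p * (n - (- j * b)) + j * c * q"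
    using bc by algebra
  then have "q dvd p * n + j" using n(3) by simp
  then obtain k where k: "p * n + j = q * k" by blast
  have nv: "real_of_int n \<in> {u..v}" using n w by auto
  have "\<bar>g n - g x\<bar> \<le> \<epsilon> * \<bar>n - x\<bar>"
    using lip[OF nv x] unfolding g_def .
  also have "\<dots> \<le> \<epsilon> * q"
    using n w eps by (intro mult_left_mono) auto
  finally have "\<bar>g n - j\<bar> \<le> \<epsilon> * q" using j by simp
  moreover have "real_of_int p * n + j = real_of_int q * k"
    using k by (metis of_int_add of_int_mult)
  then have "g n - j = q * (f n - k)"
    unfolding g_def by (simp add: algebra_simps)
  ultimately have "q * \<bar>f n - k\<bar> \<le> q * \<epsilon>"
    using q0 by (simp add: abs_mult mult.commute)
  then have "\<bar>f n - k\<bar> \<le> \<epsilon>" using q0 by simp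
  then show ?thesis using nv by auto
qed

section \<open>Using curvature\<close>

text \<open>
  At the starting point \<open>u\<close> the twist \<open>q f x - p x\<close> has a derivative in \<open>{- \<eta>..0}\<close>. Moving right,
  curvature makes that derivative more negative, so that it never changes sign: over a length \<open>l\<close>
  the twist falls by at least \<open>q \<kappa> l\<^sup>2 / 6\<close>, while its slope stays bounded by
  \<open>\<eta> + q \<kappa> l\<close>.
\<close>

lemma near_integer_right_of:
  fixes f F :: "real \<Rightarrow> real" and p q :: int and u l \<kappa> \<eta> :: real
  assumes pq: "coprime p q" "q > 0"
    and l: "q \<le> l" and var: "6 \<le> q * \<kappa> * l\<^sup>2" and \<kappa>: "0 \<le> \<kappa>"
    and deriv: "\<And>x. x \<in> {u..u + l} \<Longrightarrow> (f has_real_derivative F x) (at x)"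
    and curv: "\<And>(x::real) (y::real). x \<in> {u..u + l} \<Longrightarrow> y \<in> {u..u + l} \<Longrightarrow> x \<le> y \<Longrightarrow>
               \<kappa> / 3 * (y - x) \<le> F x - F y \<and> F x - F y \<le> \<kappa> * (y - x)"
    and start: "- \<eta> \<le> q * F u - p" "q * F u - p \<le> 0"
  shows "\<exists>(n::int) (k::int). u \<le> n \<and> n \<le> u + l \<and> \<bar>f n - k\<bar> \<le> \<eta> + q * \<kappa> * l"
proof (rule near_integer_if_twist_varies[OF pq])
  define g where "g x = q * f x - p * x" for x :: real
  define G where "G x = q * F x - p" for x :: real
  have q0: "real_of_int q > 0" using pq by simp
  have l0: "0 < l" using q0 l by linarith
  have dg: "(g has_real_derivative G x) (at x)" if "x \<in> {u..u + l}" for x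
    unfolding g_def G_def using deriv[OF that] by (auto intro!: derivative_eq_intros)
  have G_le: "G x \<le> - (q * \<kappa> / 3 * (x - u))" and G_ge: "- (\<eta> + q * \<kappa> * l) \<le> G x"
    if x: "x \<in> {u..u + l}" for x
  proof -
    have c: "\<kappa> / 3 * (x - u) \<le> F u - F x" "F u - F x \<le> \<kappa> * (x - u)"
      using curv[of u x] x l0 by auto
    have "q * (\<kappa> / 3 * (x - u)) \<le> q * (F u - F x)"
      using c q0 by (intro mult_left_mono) auto
    then show "G x \<le> - (q * \<kappa> / 3 * (x - u))"
      using start unfolding G_def by (simp add: algebra_simps)
    have "\<kappa> * (x - u) \<le> \<kappa> * l" using \<kappa> x by (intro mult_left_mono) auto
    then have "q * (F u - F x) \<le> q * (\<kappa> * l)"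
      using c q0 by (intro mult_left_mono) auto
    then show "- (\<eta> + q * \<kappa> * l) \<le> G x"
      using start unfolding G_def by (simp add: algebra_simps)
  qed
  show eps: "0 \<le> \<eta> + q * \<kappa> * l"
    using start q0 \<kappa> l0 by (smt (verit) mult_nonneg_nonneg)
  show "q \<le> u + l - u" using l by simp
  show "continuous_on {u..u + l} f"
    by (rule continuous_at_imp_continuous_on) (use deriv DERIV_isCont in blast)
  have mvt: "\<exists>z \<in> {x<..<y}. g y - g x = (y - x) * G z"
    if "x \<in> {u..u + l}" "y \<in> {u..u + l}" "x < y" for x y
    using MVT2[of x y g G] dg that by fastforce
  have Gabs: "\<bar>G z\<bar> \<le> \<eta> + q * \<kappa> * l" if "z \<in> {u..u + l}" for z
  proof -
    have "0 \<le> q * \<kappa> / 3 * (z - u)" using q0 \<kappa> that by auto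
    then show ?thesis using G_le[OF that] G_ge[OF that] eps by linarith
  qed
  have lip: "\<bar>g y - g x\<bar> \<le> (\<eta> + q * \<kappa> * l) * \<bar>y - x\<bar>"
    if xy: "x \<in> {u..u + l}" "y \<in> {u..u + l}" "x < y" for x y
  proof -
    obtain z where z: "z \<in> {x<..<y}" "g y - g x = (y - x) * G z" using mvt[OF xy] by blast
    have "\<bar>y - x\<bar> * \<bar>G z\<bar> \<le> \<bar>y - x\<bar> * (\<eta> + q * \<kappa> * l)"
      using z xy by (intro mult_left_mono Gabs) auto
    then show ?thesis using z by (simp add: abs_mult mult.commute)
  qed
  show "\<bar>(q * f x - p * x) - (q * f y - p * y)\<bar> \<le> (\<eta> + q * \<kappa> * l) * \<bar>x - y\<bar>"
    if "x \<in> {u..u + l}" "y \<in> {u..u + l}" for x y :: real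
    using lip[of x y] lip[of y x] that unfolding g_def[symmetric]
    by (cases x y rule: linorder_cases) (auto simp: abs_minus_commute)
  \<comment> \<open>Adding the parabola that the curvature guarantees leaves a function that still decreases.\<close>
  define h where "h x = g x + q * \<kappa> / 6 * (x - u)\<^sup>2" for x :: real
  have "h (u + l) \<le> h u"
  proof (rule DERIV_nonpos_imp_nonincreasing[of u "u + l" h])
    show "u \<le> u + l" using l0 by simp
    fix x assume "u \<le> x" "x \<le> u + l"
    then have x: "x \<in> {u..u + l}" by simp
    have "(h has_real_derivative G x + q * \<kappa> / 3 * (x - u)) (at x)"
      unfolding h_def using dg[OF x] by (auto intro!: derivative_eq_intros)
    then show "\<exists>y. (h has_real_derivative y) (at x) \<and> y \<le> 0"
      using G_le[OF x] by (intro exI) auto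
  qed
  then have "g (u + l) - g u \<le> - 1"
    unfolding h_def using var by simp
  then show "1 \<le> \<bar>(q * f (u + l) - p * (u + l)) - (q * f u - p * u)\<bar>"
    unfolding g_def by linarith
qed

text \<open>
  If the twist increases at \<open>u\<close>, curvature makes its slope larger to the left of \<open>u\<close>. The
  reflection \<open>x \<mapsto> - x\<close>, which preserves concavity, turns this into the previous situation.
\<close>

lemma near_integer_left_of:
  fixes f F :: "real \<Rightarrow> real" and p q :: int and u l \<kappa> \<eta> :: real
  assumes pq: "coprime p q" "q > 0"
    and l: "q \<le> l" and var: "6 \<le> q * \<kappa> * l\<^sup>2" and \<kappa>: "0 \<le> \<kappa>"
    and deriv: "\<And>x. x \<in> {u - l..u} \<Longrightarrow> (f has_real_derivative F x) (at x)"
    and curv: "\<And>(x::real) (y::real). x \<in> {u - l..u} \<Longrightarrow> y \<in> {u - l..u} \<Longrightarrow> x \<le> y \<Longrightarrow>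
               \<kappa> / 3 * (y - x) \<le> F x - F y \<and> F x - F y \<le> \<kappa> * (y - x)"
    and start: "0 \<le> q * F u - p" "q * F u - p \<le> \<eta>"
  shows "\<exists>(n::int) (k::int). u - l \<le> n \<and> n \<le> u \<and> \<bar>f n - k\<bar> \<le> \<eta> + q * \<kappa> * l"
proof -
  have "\<exists>(n::int) (k::int). - u \<le> n \<and> n \<le> - u + l \<and> \<bar>f (- real_of_int n) - k\<bar> \<le> \<eta> + q * \<kappa> * l"
  proof (rule near_integer_right_of[where f = "\<lambda>x. f (- x)" and u = "- u" and p = "- p" and F = "\<lambda>x. - F (- x)"])
    show "coprime (- p) q" using pq by simp
    show "((\<lambda>x. f (- x)) has_real_derivative - F (- x)) (at x)" if "x \<in> {- u..- u + l}" for x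
      using DERIV_mirror[THEN iffD1, of f "F (-x)" x] deriv[of "- x"] that by auto
    show "\<kappa> / 3 * (y - x) \<le> - F (- x) - - F (- y) \<and> - F (- x) - - F (- y) \<le> \<kappa> * (y - x)"
      if "x \<in> {- u..- u + l}" "y \<in> {- u..- u + l}" "x \<le> y" for x y
      using curv[of "- y" "- x"] that by auto
  qed (use assms in auto)
  then obtain n k :: int where "- u \<le> n" "n \<le> - u + l" "\<bar>f (- real_of_int n) - k\<bar> \<le> \<eta> + q * \<kappa> * l"
    by blast
  then show ?thesis by (intro exI[of _ "- n"] exI[of _ k]) auto
qed

text \<open>
  The length \<open>l = sqrt (6 / (\<kappa> q))\<close> is the shortest one over which the curvature guarantees that
  the twist moves by 1. The bound on \<open>\<kappa> q\<^sup>3\<close> says \<open>q \<le> l\<close>, so that all residue classes are met, and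
  \<open>96 \<le> \<kappa> N\<^sup>2\<close> says \<open>l \<le> N / 4\<close>, so that on either side of \<open>x\<close> there is enough room.
\<close>

lemma near_integer_of_rational_slope:
  fixes f F :: "real \<Rightarrow> real" and p q :: int and N x \<kappa> \<eta> :: real
  assumes pq: "coprime p q" "q > 0"
    and \<kappa>: "0 < \<kappa>" and N: "0 < N" "96 \<le> \<kappa> * N\<^sup>2"
    and deriv: "\<And>x. x \<in> {0..N} \<Longrightarrow> (f has_real_derivative F x) (at x)"
    and curv: "\<And>(x::real) (y::real). x \<in> {0..N} \<Longrightarrow> y \<in> {0..N} \<Longrightarrow> x \<le> y \<Longrightarrow>
               \<kappa> / 3 * (y - x) \<le> F x - F y \<and> F x - F y \<le> \<kappa> * (y - x)"
    and x: "N / 4 \<le> x" "x \<le> 3 * N / 4"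
    and slope: "\<bar>q * F x - p\<bar> \<le> \<eta>"
    and small: "\<kappa> * real_of_int q ^ 3 \<le> 6"
  shows "\<exists>(n::int) (k::int). 0 \<le> real_of_int n \<and> n \<le> N \<and> \<bar>f n - k\<bar> \<le> \<eta> + sqrt (6 * \<kappa> * q)"
proof -
  have q1: "real_of_int q \<ge> 1" using pq by simp
  define l where "l = sqrt (6 / (\<kappa> * q))"
  have l2: "l\<^sup>2 = 6 / (\<kappa> * q)" using \<kappa> q1 unfolding l_def by simp
  have var: "6 \<le> q * \<kappa> * l\<^sup>2" using \<kappa> q1 unfolding l2 by (simp add: field_simps)
  have ql: "q \<le> l"
    unfolding l_def using \<kappa> q1 small
    by (intro real_le_rsqrt) (simp add: field_simps power2_eq_square power3_eq_cube)
  have "6 / (\<kappa> * q) \<le> 6 / \<kappa>" using \<kappa> q1 by (intro divide_left_mono) auto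
  also have "6 / \<kappa> \<le> (N / 4)\<^sup>2" using \<kappa> N by (simp add: field_simps)
  finally have lN: "l \<le> N / 4" unfolding l_def using N by (intro real_le_lsqrt) auto
  have "q * \<kappa> * l = sqrt ((q * \<kappa>)\<^sup>2) * l" using \<kappa> q1 by simp
  also have "\<dots> = sqrt (6 * \<kappa> * q)"
    unfolding l_def real_sqrt_mult[symmetric] using \<kappa> q1
    by (simp add: power2_eq_square field_simps)
  finally have err: "\<eta> + q * \<kappa> * l = \<eta> + sqrt (6 * \<kappa> * q)" by simp
  show ?thesis
  proof (cases "q * F x - p \<le> 0")
    case True
    have "\<exists>(n::int) (k::int). x \<le> n \<and> n \<le> x + l \<and> \<bar>f n - k\<bar> \<le> \<eta> + q * \<kappa> * l"
    proof (rule near_integer_right_of[OF pq ql var])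
      show "\<kappa> / 3 * (z - y) \<le> F y - F z \<and> F y - F z \<le> \<kappa> * (z - y)"
        if "y \<in> {x..x + l}" "z \<in> {x..x + l}" "y \<le> z" for y z
        using curv[of y z] that x lN N by simp
    qed (use \<kappa> lN N x True slope in \<open>auto intro!: deriv\<close>)
    then obtain n k :: int where "x \<le> n" "n \<le> x + l" "\<bar>f n - k\<bar> \<le> \<eta> + q * \<kappa> * l"
      by blast
    then show ?thesis unfolding err using x N lN by (intro exI[of _ n] exI[of _ k]) auto
  next
    case False
    have "\<exists>(n::int) (k::int). x - l \<le> n \<and> n \<le> x \<and> \<bar>f n - k\<bar> \<le> \<eta> + q * \<kappa> * l"
    proof (rule near_integer_left_of[OF pq ql var])
      show "\<kappa> / 3 * (z - y) \<le> F y - F z \<and> F y - F z \<le> \<kappa> * (z - y)"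
        if "y \<in> {x - l..x}" "z \<in> {x - l..x}" "y \<le> z" for y z
        using curv[of y z] that x lN N by simp
    qed (use \<kappa> lN N x False slope in \<open>auto intro!: deriv\<close>)
    then obtain n k :: int where "x - l \<le> n" "n \<le> x" "\<bar>f n - k\<bar> \<le> \<eta> + q * \<kappa> * l"
      by blast
    then show ?thesis unfolding err using x N lN by (intro exI[of _ n] exI[of _ k]) auto
  qed
qed

text \<open>
  The proof balances the denominator \<open>q\<close> of the slope against the total change \<open>V = \<kappa> N\<close> of the
  slope. The threshold \<open>48 / sqrt N\<close> for \<open>V\<close> is chosen so that the denominators used
  in both cases satisfy \<open>\<kappa> q\<^sup>3 \<le> 6\<close>.
\<close>

lemma near_integer_of_curved:
  fixes f F :: "real \<Rightarrow> real" and N \<kappa> :: real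
  assumes \<kappa>: "0 < \<kappa>" "\<kappa> \<le> 1" and N: "0 < N" "96 \<le> \<kappa> * N\<^sup>2"
    and deriv: "\<And>x. x \<in> {0..N} \<Longrightarrow> (f has_real_derivative F x) (at x)"
    and curv: "\<And>(x::real) (y::real). x \<in> {0..N} \<Longrightarrow> y \<in> {0..N} \<Longrightarrow> x \<le> y \<Longrightarrow>
               \<kappa> / 3 * (y - x) \<le> F x - F y \<and> F x - F y \<le> \<kappa> * (y - x)"
  shows "\<exists>(n::int) (k::int). 0 \<le> real_of_int n \<and> n \<le> N \<and> \<bar>f n - k\<bar> \<le> 16 * (sqrt \<kappa> + 1 / sqrt N)"
proof -
  define s where "s = sqrt N"
  have s0: "s > 0" and Ns: "N = s\<^sup>2" using N unfolding s_def by auto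
  have "\<kappa> * N\<^sup>2 \<le> 1 * N\<^sup>2" using \<kappa> by (intro mult_right_mono) auto
  then have "9\<^sup>2 \<le> N\<^sup>2" using N(2) by simp
  then have N9: "9 \<le> N" using N(1) by (auto intro: power2_le_imp_le)
  then have s3: "3 \<le> s" unfolding s_def by (intro real_le_rsqrt) simp
  have weaken: ?thesis
    if "\<exists>(n::int) (k::int). 0 \<le> real_of_int n \<and> n \<le> N \<and> \<bar>f n - k\<bar> \<le> e"
      and "e \<le> 16 * (sqrt \<kappa> + 1 / s)" for e
    using that unfolding s_def by (meson order_trans)
  show ?thesis
  proof (cases "48 \<le> \<kappa> * N * s")
    case True
    define V where "V = \<kappa> * N"
    have V: "V > 0" using \<kappa> N unfolding V_def by simp
    \<comment> \<open>From the midpoint to either quarter point the slope changes by at least \<open>V / 12\<close>. With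
      denominators up to \<open>\<lceil>12 / V\<rceil>\<close> the approximation error is no larger, so the fraction is
      a value of the slope.\<close>
    define Q where "Q = nat \<lceil>12 / V\<rceil>"
    have "0 < 12 / V" using V by simp
    then have ceil0: "0 < \<lceil>12 / V\<rceil>" by simp
    then have Q0: "Q > 0" and Qr: "real Q = \<lceil>12 / V\<rceil>" unfolding Q_def by auto
    obtain p q where pq: "coprime p q" "0 < q" and qQ: "q \<le> int Q"
      and app: "\<bar>of_int q * F (N / 2) - of_int p\<bar> < 1 / Q"
      using Dirichlet_approx_coprime[OF Q0] by metis
    have q1: "real_of_int q \<ge> 1" using pq by simp
    have "12 / V \<le> Q" unfolding Qr by linarith
    then have "1 / Q \<le> V / 12" using V Q0 by (simp add: field_simps)
    then have app': "\<bar>q * F (N / 2) - p\<bar> \<le> V / 12" using app by linarith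
    have q_le: "real_of_int q \<le> \<lceil>12 / V\<rceil>"
      using qQ unfolding Q_def using ceil0 by linarith
    then have q_le': "q \<le> 12 / V + 1" by linarith
    have step: "V / 12 \<le> q * (F y - F z)"
      if "y \<in> {0..N}" "z \<in> {0..N}" "z - y = N / 4" for y z
    proof -
      have "V / 12 \<le> F y - F z" using curv[of y z] that N unfolding V_def by auto
      moreover have "1 * (F y - F z) \<le> q * (F y - F z)"
        using q1 calculation V by (intro mult_right_mono) auto
      ultimately show ?thesis by simp
    qed
    have "V / 12 \<le> q * F (N / 4) - q * F (N / 2)" "V / 12 \<le> q * F (N / 2) - q * F (3 * N / 4)"
      using step[of "N / 4" "N / 2"] step[of "N / 2" "3 * N / 4"] N
      by (auto simp: right_diff_distrib)
    then have "p \<le> q * F (N / 4)" "q * F (3 * N / 4) \<le> p" using app' by linarith+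
    then have "p / q \<le> F (N / 4)" "F (3 * N / 4) \<le> p / q" using q1 by (auto simp: field_simps)
    moreover have "continuous_on {N / 4..3 * N / 4} F"
    proof (rule lipschitz_on_continuous_on)
      have *: "\<bar>F y - F z\<bar> \<le> \<kappa> * \<bar>y - z\<bar>" if "y \<in> {0..N}" "z \<in> {0..N}" "y \<le> z" for y z
      proof -
        have "0 \<le> \<kappa> / 3 * (z - y)" using \<kappa> that by simp
        then show ?thesis using curv[OF that] that by (simp add: abs_if)
      qed
      show "\<kappa>-lipschitz_on {N / 4..3 * N / 4} F"
      proof (rule lipschitz_onI)
        fix y z assume yz: "y \<in> {N / 4..3 * N / 4}" "z \<in> {N / 4..3 * N / 4}"
        show "dist (F y) (F z) \<le> \<kappa> * dist y z"
          using *[of y z] *[of z y] yz N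
          by (cases "y \<le> z") (auto simp: dist_real_def abs_minus_commute)
      qed (use \<kappa> in auto)
    qed
    ultimately obtain x where x: "N / 4 \<le> x" "x \<le> 3 * N / 4" "F x = p / q"
      using IVT2'[of F "3 * N / 4" "p / q" "N / 4"] N by auto
    have small: "\<kappa> * real_of_int q ^ 3 \<le> 6"
    proof (cases "12 \<le> V")
      case True
      then have "\<lceil>12 / V\<rceil> \<le> 1" by (simp add: ceiling_le_iff)
      then have "q = 1" using q_le q1 by linarith
      then show ?thesis using \<kappa> by simp
    next
      case False
      then have "1 \<le> 12 / V" using V by simp
      then have "q \<le> 24 / V" using q_le' by linarith
      then have qV: "q * V \<le> 24" using V by (simp add: field_simps)
      have Vs: "V * s \<ge> 48" using True V_def by simp
      have "real_of_int q * 48 \<le> q * (V * s)" using Vs q1 by (intro mult_left_mono) auto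
      also have "\<dots> \<le> 24 * s" using qV s0 by (simp add: mult.assoc[symmetric])
      finally have "2 * q \<le> s" by simp
      then have "(2 * real_of_int q)\<^sup>2 \<le> s\<^sup>2" using q1 by (intro power_mono) auto
      then have q2: "4 * real_of_int q ^ 2 \<le> N" using Ns by (simp add: power_mult_distrib)
      have "\<kappa> * q * (4 * real_of_int q ^ 2) \<le> \<kappa> * q * N" using q2 \<kappa> q1 by (intro mult_left_mono) auto
      also have "\<dots> \<le> 24" using qV unfolding V_def by (simp add: mult_ac)
      finally show ?thesis by (simp add: power2_eq_square power3_eq_cube)
    qed
    have "\<exists>(n::int) (k::int). 0 \<le> real_of_int n \<and> n \<le> N \<and> \<bar>f n - k\<bar> \<le> 0 + sqrt (6 * \<kappa> * q)"
      by (rule near_integer_of_rational_slope[where F = F and x = x])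
        (use pq \<kappa> N deriv curv small x q1 in auto)
    moreover have "sqrt (6 * \<kappa> * q) \<le> 16 * (sqrt \<kappa> + 1 / s)"
    proof (rule real_le_lsqrt)
      have "6 * \<kappa> * q \<le> 6 * \<kappa> * (12 / V + 1)" using q_le' \<kappa> by (intro mult_left_mono) auto
      also have "\<dots> = 72 / N + 6 * \<kappa>" unfolding V_def using \<kappa> N by (simp add: field_simps)
      also have "\<dots> = 72 * (1 / s)\<^sup>2 + 6 * (sqrt \<kappa>)\<^sup>2" using \<kappa> by (simp add: Ns power_divide)
      also have "\<dots> \<le> (16 * (sqrt \<kappa> + 1 / s))\<^sup>2"
      proof -
        have "72 * c\<^sup>2 + 6 * b\<^sup>2 \<le> (16 * (b + c))\<^sup>2" if "0 \<le> b" "0 \<le> c" for b c :: real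
        proof -
          have "(16 * (b + c))\<^sup>2 = 256 * b\<^sup>2 + 512 * (b * c) + 256 * c\<^sup>2"
            by (simp add: power2_eq_square algebra_simps)
          moreover have "0 \<le> b * c" "0 \<le> b\<^sup>2" "0 \<le> c\<^sup>2" using that by auto
          ultimately show ?thesis by linarith
        qed
        from this[of "sqrt \<kappa>" "1 / s"] show ?thesis using \<kappa> s0 by simp
      qed
      finally show "6 * \<kappa> * q \<le> (16 * (sqrt \<kappa> + 1 / s))\<^sup>2" .
    qed (use \<kappa> s0 q1 in auto)
    ultimately show ?thesis by (intro weaken) auto
  next
    case False
    \<comment> \<open>The slope changes little. The midpoint serves as starting point although the fraction need not be
      a value of the slope: the error \<open>4 / s\<close> is of the order allowed.\<close>
    define Q where "Q = nat \<lfloor>s / 2\<rfloor>"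
    have Qr: "real Q = \<lfloor>s / 2\<rfloor>" unfolding Q_def using s3 by simp
    have "1 \<le> \<lfloor>s / 2\<rfloor>" using s3 by (simp add: le_floor_iff)
    then have Q: "Q > 0" "s / 4 \<le> Q" "Q \<le> s / 2"
      unfolding Qr using Q_def by (simp, linarith+)
    obtain p q where pq: "coprime p q" "0 < q" and qQ: "q \<le> int Q"
      and app: "\<bar>of_int q * F (N / 2) - of_int p\<bar> < 1 / Q"
      using Dirichlet_approx_coprime[OF Q(1)] by metis
    have q1: "real_of_int q \<ge> 1" using pq by simp
    have qs: "2 * q \<le> s" using qQ Q(3) by linarith
    have "1 / Q \<le> 4 / s" using Q s0 by (simp add: field_simps)
    then have slope: "\<bar>q * F (N / 2) - p\<bar> \<le> 4 / s" using app by linarith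
    have lam: "\<kappa> * s ^ 3 \<le> 48"
      using False Ns by (simp add: power2_eq_square power3_eq_cube mult_ac)
    have "\<kappa> * (2 * real_of_int q) ^ 3 \<le> \<kappa> * s ^ 3"
      using qs q1 \<kappa> by (intro mult_left_mono power_mono) auto
    then have small: "\<kappa> * real_of_int q ^ 3 \<le> 6" using lam by (simp add: power_mult_distrib)
    have near: "\<exists>(n::int) (k::int). 0 \<le> real_of_int n \<and> n \<le> N \<and> \<bar>f n - k\<bar> \<le> 4 / s + sqrt (6 * \<kappa> * q)"
      by (rule near_integer_of_rational_slope[where F = F and x = "N / 2"])
        (use pq \<kappa> N deriv curv slope small in auto)
    have "sqrt (6 * \<kappa> * q) \<le> 12 / s"
    proof (rule real_le_lsqrt)
      have "\<kappa> * s\<^sup>2 * (2 * q) \<le> \<kappa> * s\<^sup>2 * s" using qs \<kappa> by (intro mult_left_mono) auto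
      also have "\<dots> \<le> 48" using lam by (simp add: power2_eq_square power3_eq_cube mult_ac)
      finally show "6 * \<kappa> * q \<le> (12 / s)\<^sup>2" using s0 by (simp add: field_simps power_divide)
    qed (use s0 \<kappa> q1 in auto)
    moreover have "4 / s + 12 / s \<le> 16 * (sqrt \<kappa> + 1 / s)" using \<kappa> s0 by (simp add: field_simps)
    ultimately have "4 / s + sqrt (6 * \<kappa> * q) \<le> 16 * (sqrt \<kappa> + 1 / s)" by linarith
    with near show ?thesis by (rule weaken)
  qed
qed

section \<open>Squares near arithmetic progressions\<close>

text \<open>
  With \<open>f x = sqrt (a + d x)\<close> the derivative is \<open>d / (2 f x)\<close>, and its difference at \<open>x \<le> y\<close> is
  \<open>d\<^sup>2 (y - x)\<close> over \<open>2 f x f y (f x + f y)\<close>. As \<open>f\<close> stays between \<open>sqrt a\<close> and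
  \<open>sqrt (2 a)\<close>, that denominator varies by a factor of at most \<open>2 sqrt 2 < 3\<close>.
\<close>

lemma sqrt_progression_near_integer:
  fixes a d N :: int
  defines "\<kappa> \<equiv> real_of_int d ^ 2 / (4 * sqrt (real_of_int a) ^ 3)"
  assumes d: "d \<ge> 1" and N: "N \<ge> 1" and a: "N * d \<le> a"
    and \<kappa>: "\<kappa> \<le> 1" "96 \<le> \<kappa> * real_of_int N ^ 2"
  shows "\<exists>(n::int) (k::int). 0 \<le> n \<and> n \<le> N \<and>
           \<bar>sqrt (a + n * d) - k\<bar> \<le> 16 * (sqrt \<kappa> + 1 / sqrt N)"
proof -
  define f where "f x = sqrt (a + x * d)" for x :: real
  define F where "F x = d / (2 * f x)" for x :: real
  have a1: "1 \<le> a" using mult_mono[of 1 N 1 d] N d a by simp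
  define r where "r = sqrt (real_of_int a)"
  have r0: "r > 0" using a1 unfolding r_def by simp
  have d0: "real_of_int d > 0" using d by simp
  have Nd: "real_of_int N * d \<le> a" using a by (metis of_int_le_iff of_int_mult)
  have f: "r \<le> f x" "f x \<le> sqrt 2 * r" and f2: "(f x)\<^sup>2 = a + x * d"
    if "x \<in> {0..real_of_int N}" for x :: real
  proof -
    have *: "0 \<le> x * d" "x * d \<le> N * d" using that d0 by (auto intro: mult_right_mono)
    then show "(f x)\<^sup>2 = a + x * d" unfolding f_def using a1 by simp
    show "r \<le> f x" unfolding r_def f_def using * by simp
    show "f x \<le> sqrt 2 * r" unfolding r_def f_def real_sqrt_mult[symmetric]
      using * Nd by simp
  qed
  have pos: "\<kappa> > 0" unfolding \<kappa>_def r_def[symmetric] using r0 d0 by simp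
  have "\<exists>(n::int) (k::int). 0 \<le> real_of_int n \<and> real_of_int n \<le> real_of_int N \<and>
          \<bar>f n - k\<bar> \<le> 16 * (sqrt \<kappa> + 1 / sqrt N)"
  proof (rule near_integer_of_curved[OF pos \<kappa>(1) _ \<kappa>(2)])
    fix x assume x: "x \<in> {0..real_of_int N}"
    have "0 \<le> x * d" using x d0 by simp
    then have p: "0 < a + x * d" using a1 by linarith
    show "(f has_real_derivative F x) (at x)"
      unfolding f_def F_def using p by (auto intro!: derivative_eq_intros simp: field_simps)
    fix y assume y: "y \<in> {0..real_of_int N}" and xy: "x \<le> y"
    define D where "D = f x * f y * (f x + f y)"
    have fx: "0 < f x" "0 < f y" using f[OF x] f[OF y] r0 by linarith+
    have D0: "D > 0" unfolding D_def using fx by (intro mult_pos_pos add_pos_pos)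
    have "(f y - f x) * (f x + f y) = d * (y - x)"
      using f2[OF x] f2[OF y] by (simp add: power2_eq_square algebra_simps)
    then have "f y - f x = d * (y - x) / (f x + f y)" using fx by (simp add: field_simps)
    moreover have "F x - F y = d * (f y - f x) / (2 * f x * f y)"
      unfolding F_def using fx by (simp add: field_simps)
    ultimately have "F x - F y = d * (d * (y - x) / (f x + f y)) / (2 * f x * f y)" by simp
    also have "\<dots> = real_of_int d ^ 2 * (y - x) / (2 * D)"
      unfolding D_def by (simp add: power2_eq_square mult_ac)
    finally have FD: "F x - F y = real_of_int d ^ 2 * (y - x) / (2 * D)" .
    have "r * r * (r + r) \<le> D" unfolding D_def
      using f[OF x] f[OF y] r0 by (intro mult_mono add_mono) auto
    then have D1: "2 * r ^ 3 \<le> D" by (simp add: power3_eq_cube algebra_simps)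
    have "D \<le> (sqrt 2 * r) * (sqrt 2 * r) * (sqrt 2 * r + sqrt 2 * r)" unfolding D_def
      using f[OF x] f[OF y] r0 fx by (intro mult_mono add_mono) auto
    also have "\<dots> = 4 * sqrt 2 * r ^ 3" by (simp add: power3_eq_cube algebra_simps)
    also have "\<dots> \<le> 4 * (3 / 2) * r ^ 3"
      using r0 by (intro mult_right_mono mult_left_mono real_le_lsqrt) (auto simp: power2_eq_square)
    finally have D2: "D \<le> 6 * r ^ 3" by simp
    have n0: "0 \<le> real_of_int d ^ 2 * (y - x)" using xy by simp
    have r3: "0 < r ^ 3" using r0 by simp
    have "real_of_int d ^ 2 * (y - x) / (2 * D) \<le> real_of_int d ^ 2 * (y - x) / (4 * r ^ 3)"
      using n0 D1 mult_pos_pos[OF D0 r3] by (intro divide_left_mono) auto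
    moreover have "real_of_int d ^ 2 * (y - x) / (12 * r ^ 3) \<le> real_of_int d ^ 2 * (y - x) / (2 * D)"
      using n0 D2 mult_pos_pos[OF D0 r3] by (intro divide_left_mono) auto
    ultimately show "\<kappa> / 3 * (y - x) \<le> F x - F y \<and> F x - F y \<le> \<kappa> * (y - x)"
      unfolding FD \<kappa>_def r_def[symmetric] by simp
  qed (use N in auto)
  then show ?thesis unfolding f_def by simp
qed

lemma cube_powr:
  fixes x :: real
  assumes "x > 0"
  shows "(x powr (2 / 3)) ^ 3 = x\<^sup>2" "(x powr (4 / 3)) ^ 3 = x ^ 4"
  using assms by (simp_all add: powr_power)

text \<open>
  Factor \<open>z\<^sup>2 - k\<^sup>2\<close> with \<open>z = sqrt (a + n d)\<close>; the bound \<open>\<epsilon> \<le> 24\<close> keeps \<open>z + k\<close> of order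
  \<open>sqrt a\<close>, since \<open>2 z + 24 \<le> 27 sqrt a\<close>.
\<close>

lemma square_dist_le_of_sqrt_near_integer:
  fixes a d N n k :: int and \<epsilon> :: real
  assumes d: "d \<ge> 1" and N: "N \<ge> 1" and a: "N * d \<le> a" and n: "0 \<le> n" "n \<le> N"
    and k: "\<bar>sqrt (a + n * d) - k\<bar> \<le> \<epsilon>" and \<epsilon>: "\<epsilon> \<le> 24"
  shows "square_dist a d N \<le> 27 * sqrt a * \<epsilon>"
proof -
  define z where "z = sqrt (a + n * d)"
  have a1: "1 \<le> a" using mult_mono[of 1 N 1 d] N d a by simp
  have nd: "0 \<le> n * d" "n * d \<le> a" using n d a mult_right_mono[of n N d] by (simp, linarith)
  have nonneg: "0 \<le> real_of_int a + n * d" using a1 nd by linarith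
  then have z2: "z\<^sup>2 = a + n * d" and z0: "0 \<le> z" unfolding z_def by auto
  have r1: "1 \<le> sqrt a" using a1 by simp
  have "z \<le> 3 / 2 * sqrt a"
  proof (rule power2_le_imp_le)
    have "(3 / 2 * sqrt a)\<^sup>2 = 9 / 4 * a" using a1 by (simp add: power_mult_distrib power_divide)
    then show "z\<^sup>2 \<le> (3 / 2 * sqrt a)\<^sup>2" unfolding z2 using nd a1 by linarith
  qed (use r1 in auto)
  then have sum: "\<bar>z + k\<bar> \<le> 27 * sqrt a"
    using k \<epsilon> z0 r1 unfolding z_def[symmetric] by linarith
  have "square_dist a d N \<le> \<bar>a + n * d - k\<^sup>2\<bar>"
    using square_dist_le[of N n a d k] N n by simp
  then have "real_of_int (square_dist a d N) \<le> real_of_int \<bar>a + n * d - k\<^sup>2\<bar>"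
    by (rule of_int_le_iff[THEN iffD2])
  also have "real_of_int \<bar>a + n * d - k\<^sup>2\<bar> = \<bar>z\<^sup>2 - (real_of_int k)\<^sup>2\<bar>" unfolding z2 by simp
  also have "\<dots> = \<bar>z + k\<bar> * \<bar>z - k\<bar>"
    by (simp add: abs_mult[symmetric] power2_eq_square algebra_simps)
  also have "\<dots> \<le> 27 * sqrt a * \<epsilon>"
    using sum k unfolding z_def[symmetric] by (intro mult_mono) (use r1 in auto)
  finally show ?thesis .
qed

theorem theorem2:
  "\<exists>C::real. C > 0 \<and> (\<forall>a d N :: int.
     a \<ge> 0 \<and> d \<ge> 1 \<and> N \<ge> 1 \<and>
     real_of_int a \<le> ((real_of_int N * real_of_int d - 1) / 2)\<^sup>2 \<and>
     real_of_int a \<le> real_of_int N powr (4/3) * real_of_int d powr (4/3) / 200 \<longrightarrow>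
     (max (real_of_int N * real_of_int d) (real_of_int N powr (2/3) * real_of_int d powr (4/3))
          \<le> real_of_int a \<and>
      real_of_int a \<le> real_of_int N powr (4/3) * real_of_int d powr (4/3) / 200 \<longrightarrow>
        real_of_int (square_dist a d N)
          \<le> C * (real_of_int a powr (1/2) / real_of_int N powr (1/2))) \<and>
     (max (real_of_int N * real_of_int d) (real_of_int d powr (4/3)) \<le> real_of_int a \<and>
      real_of_int a \<le> real_of_int N powr (2/3) * real_of_int d powr (4/3) \<longrightarrow>
        real_of_int (square_dist a d N)
          \<le> C * (real_of_int d / real_of_int a powr (1/4))))"
proof (intro exI[of _ "648 :: real"] conjI allI impI)
  fix a d N :: int
  assume "a \<ge> 0 \<and> d \<ge> 1 \<and> N \<ge> 1 \<and>
     real_of_int a \<le> ((real_of_int N * real_of_int d - 1) / 2)\<^sup>2 \<and>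
     real_of_int a \<le> real_of_int N powr (4/3) * real_of_int d powr (4/3) / 200"
  then have d: "d \<ge> 1" and N: "N \<ge> 1"
    and up: "200 * real_of_int a \<le> real_of_int N powr (4/3) * real_of_int d powr (4/3)" by auto
  define r where "r = sqrt (real_of_int a)"
  define \<kappa> where "\<kappa> = real_of_int d ^ 2 / (4 * r ^ 3)"
  define \<epsilon> where "\<epsilon> = 16 * (sqrt \<kappa> + 1 / sqrt (real_of_int N))"
  have d0: "real_of_int d > 0" and N1: "real_of_int N \<ge> 1" using d N by auto
  note cubes = cube_powr[OF d0] cube_powr[of "real_of_int N"]

  \<comment> \<open>What both ranges share: \<open>96 \<le> \<kappa> N\<^sup>2\<close> comes from the upper bound on \<open>a\<close>, cubed to clear
    the fractional exponents.\<close>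
  have bound: "square_dist a d N \<le> 27 * r * \<epsilon>"
    if Nd: "real_of_int N * real_of_int d \<le> real_of_int a" and dr: "real_of_int d ^ 2 \<le> r ^ 3"
      and \<epsilon>: "\<epsilon> \<le> 24"
  proof -
    have a: "N * d \<le> a" using Nd by (metis of_int_le_iff of_int_mult)
    have a1: "1 \<le> a" using mult_mono[of 1 N 1 d] N d a by simp
    then have r: "r > 0" and r2: "r\<^sup>2 = a" unfolding r_def by auto
    have "(384 * r ^ 3)\<^sup>2 \<le> (200 * r\<^sup>2) ^ 3" using r by (simp add: power_mult_distrib)
    also have "\<dots> \<le> (real_of_int N powr (4/3) * real_of_int d powr (4/3)) ^ 3"
      using up a1 r2 by (intro power_mono) simp_all
    also have "\<dots> = (real_of_int N ^ 2 * real_of_int d ^ 2) ^ 2"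
      using cubes N1 by (simp add: power_mult_distrib)
    finally have "(384 * r ^ 3) ^ 2 \<le> (real_of_int N ^ 2 * real_of_int d ^ 2) ^ 2"
      using zero_less_power[OF r, of 6] by (simp add: power_mult_distrib)
    then have "384 * r ^ 3 \<le> real_of_int N ^ 2 * real_of_int d ^ 2"
      by (rule power2_le_imp_le) simp
    then have "96 \<le> \<kappa> * real_of_int N ^ 2" unfolding \<kappa>_def using r by (simp add: field_simps)
    moreover have "real_of_int d ^ 2 \<le> 4 * r ^ 3"
      using dr zero_less_power[OF r, of 3] by linarith
    then have "\<kappa> \<le> 1" unfolding \<kappa>_def using r dr by (simp add: field_simps)
    ultimately obtain n k :: int where "0 \<le> n" "n \<le> N" "\<bar>sqrt (a + n * d) - k\<bar> \<le> \<epsilon>"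
      using sqrt_progression_near_integer[OF d N a] unfolding \<kappa>_def \<epsilon>_def r_def by blast
    then show ?thesis
      using square_dist_le_of_sqrt_near_integer[OF d N a] \<epsilon> unfolding r_def by blast
  qed

  {
    assume "max (real_of_int N * real_of_int d) (real_of_int N powr (2/3) * real_of_int d powr (4/3))
          \<le> real_of_int a \<and>
      real_of_int a \<le> real_of_int N powr (4/3) * real_of_int d powr (4/3) / 200"
    then have Nd: "real_of_int N * real_of_int d \<le> real_of_int a"
      and low: "real_of_int N powr (2/3) * real_of_int d powr (4/3) \<le> real_of_int a" by auto
    have "0 < real_of_int N * real_of_int d" using d0 N1 by simp
    then have r: "r > 0" and r2: "r\<^sup>2 = a" using Nd unfolding r_def by auto
    have "(real_of_int N powr (2/3) * real_of_int d powr (4/3)) ^ 3 \<le> (r\<^sup>2) ^ 3"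
      using low r2 by (intro power_mono) auto
    then have "(real_of_int N * real_of_int d ^ 2)\<^sup>2 \<le> (r ^ 3)\<^sup>2"
      using cubes N1 by (simp add: power_mult_distrib)
    then have Ndr: "real_of_int N * real_of_int d ^ 2 \<le> r ^ 3"
      by (rule power2_le_imp_le) (use r in simp)
    have "1 * real_of_int d ^ 2 \<le> real_of_int N * real_of_int d ^ 2"
      using N1 by (intro mult_right_mono) auto
    with Ndr have dr: "real_of_int d ^ 2 \<le> r ^ 3" by linarith
    \<comment> \<open>Here \<open>\<kappa> \<le> 1 / (4 N)\<close>, so the term \<open>1 / sqrt N\<close> dominates.\<close>
    have "\<kappa> \<le> (1 / (2 * sqrt N))\<^sup>2"
      unfolding \<kappa>_def using Ndr r N1 by (simp add: field_simps power_mult_distrib)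
    then have "sqrt \<kappa> \<le> 1 / (2 * sqrt N)" using N1 by (intro real_le_lsqrt) auto
    then have \<epsilon>: "\<epsilon> \<le> 24 / sqrt N" unfolding \<epsilon>_def by simp
    also have "24 / sqrt N \<le> 24" using N1 by (simp add: field_simps)
    finally have "square_dist a d N \<le> 27 * r * \<epsilon>" by (rule bound[OF Nd dr])
    also have "\<dots> \<le> 27 * r * (24 / sqrt N)" using \<epsilon> r by (intro mult_left_mono) auto
    finally show "real_of_int (square_dist a d N)
          \<le> 648 * (real_of_int a powr (1/2) / real_of_int N powr (1/2))"
      using r2 r N1 by (simp add: powr_half_sqrt r_def)
  }
  {
    assume "max (real_of_int N * real_of_int d) (real_of_int d powr (4/3)) \<le> real_of_int a \<and>
      real_of_int a \<le> real_of_int N powr (2/3) * real_of_int d powr (4/3)"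
    then have Nd: "real_of_int N * real_of_int d \<le> real_of_int a"
      and low: "real_of_int d powr (4/3) \<le> real_of_int a"
      and upp: "real_of_int a \<le> real_of_int N powr (2/3) * real_of_int d powr (4/3)" by auto
    have "0 < real_of_int N * real_of_int d" using d0 N1 by simp
    then have a0: "0 < real_of_int a" using Nd by linarith
    then have r: "r > 0" and r2: "r\<^sup>2 = a" unfolding r_def by auto
    have "(r\<^sup>2) ^ 3 \<le> (real_of_int N powr (2/3) * real_of_int d powr (4/3)) ^ 3"
      using upp r2 a0 by (intro power_mono) simp_all
    then have "(r ^ 3)\<^sup>2 \<le> (real_of_int N * real_of_int d ^ 2)\<^sup>2"
      using cubes N1 by (simp add: power_mult_distrib)
    then have Ndr: "r ^ 3 \<le> real_of_int N * real_of_int d ^ 2"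
      by (rule power2_le_imp_le) (use N1 in simp)
    have "(real_of_int d powr (4/3)) ^ 3 \<le> (r\<^sup>2) ^ 3"
      using low r2 by (intro power_mono) auto
    then have "(real_of_int d ^ 2)\<^sup>2 \<le> (r ^ 3)\<^sup>2" using cubes by simp
    then have dr: "real_of_int d ^ 2 \<le> r ^ 3" by (rule power2_le_imp_le) (use r in simp)
    \<comment> \<open>Here \<open>1 / (4 N) \<le> \<kappa>\<close>, so the term \<open>sqrt \<kappa>\<close> dominates.\<close>
    define w where "w = sqrt \<kappa>"
    have w2: "w\<^sup>2 = \<kappa>" and w0: "0 \<le> w" unfolding w_def \<kappa>_def using r by auto
    have w: "w \<le> 1 / 2"
      unfolding w_def by (rule real_le_lsqrt)
        (use r dr in \<open>auto simp: \<kappa>_def field_simps power2_eq_square\<close>)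
    have "(1 / sqrt N)\<^sup>2 \<le> (2 * w)\<^sup>2"
      unfolding power_mult_distrib w2 \<kappa>_def using Ndr r N1 by (simp add: field_simps power_divide)
    then have "1 / sqrt N \<le> 2 * w" by (rule power2_le_imp_le) (use w0 in simp)
    then have \<epsilon>: "\<epsilon> \<le> 48 * w" unfolding \<epsilon>_def w_def by simp
    also have "48 * w \<le> 24" using w by simp
    finally have "square_dist a d N \<le> 27 * r * \<epsilon>" by (rule bound[OF Nd dr])
    also have "\<dots> \<le> 27 * r * (48 * w)" using \<epsilon> r by (intro mult_left_mono) auto
    also have "2 * r * w = d / sqrt r"
    proof (rule power2_eq_imp_eq)
      show "(2 * r * w)\<^sup>2 = (d / sqrt r)\<^sup>2"
        unfolding power_mult_distrib w2 \<kappa>_def power_divide using r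
        by (simp add: power2_eq_square power3_eq_cube field_simps)
    qed (use r w0 d0 in auto)
    then have "27 * r * (48 * w) = 648 * (d / sqrt r)" by simp
    also have "sqrt r = real_of_int a powr (1/4)"
      unfolding r_def using a0 by (simp add: powr_powr flip: powr_half_sqrt)
    finally show "real_of_int (square_dist a d N) \<le> 648 * (real_of_int d / real_of_int a powr (1/4))" .
  }
qed simp

end
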